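(* Let $w_{1},w_{2},w_{3}$ be any positive integers and $n\ge 0$ an integer. Then for all $y_1,y_2,y_3$ the following six expressions are equal: \begin{align*} &\sum_{k+l+m=n}\binom{n}{k,l,m}E_{k}(w_{1}y_{1})E_{l}(w_{2}y_{2})E_{m}(w_{3}y_{3})w_{1}^{l+m}w_{2}^{k+m}w_{3}^{k+l}\\ =&\sum_{k+l+m=n}\binom{n}{k,l,m}E_{k}(w_{1}y_{1})E_{l}(w_{3}y_{2})E_{m}(w_{2}y_{3})w_{1}^{l+m}w_{3}^{k+m}w_{2}^{k+l}\\ =&\sum_{k+l+m=n}\binom{n}{k,l,m}E_{k}(w_{2}y_{1})E_{l}(w_{1}y_{2})E_{m}(w_{3}y_{3})w_{2}^{l+m}w_{1}^{k+m}w_{3}^{k+l}\\ =&\sum_{k+l+m=n}\binom{n}{k,l,m}E_{k}(w_{2}y_{1})E_{l}(w_{3}y_{2})E_{m}(w_{1}y_{3})w_{2}^{l+m}w_{3}^{k+m}w_{1}^{k+l}\\ =&\sum_{k+l+m=n}\binom{n}{k,l,m}E_{k}(w_{3}y_{1})E_{l}(w_{1}y_{2})E_{m}(w_{2}y_{3})w_{3}^{l+m}w_{1}^{k+m}w_{2}^{k+l}\\ =&\sum_{k+l+m=n}\binom{n}{k,l,m}E_{k}(w_{3}y_{1})E_{l}(w_{2}y_{2})E_{m}(w_{1}y_{3})w_{3}^{l+m}w_{2}^{k+m}w_{1}^{k+l}. \end{align*}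
   Context: The Euler polynomials $E_n(x)$ are defined by $\frac{2}{e^{t}+1}e^{xt}=\sum_{n=0}^{\infty}E_{n}(x)\frac{t^{n}}{n!}$. Sums $\sum_{k+l+m=n}$ run over all nonnegative integers $k,l,m$ with $k+l+m=n$, and $\binom{n}{k,l,m}=\frac{n!}{k!\,l!\,m!}$. *)

theory Defs
  imports "HOL-Computational_Algebra.Formal_Power_Series" "HOL-Computational_Algebra.Polynomial"
begin

text \<open>
  The quotient is taken in the ring of formal power series in the variable \<open>t\<close>. The constant
  coefficient of \<open>e\<^sup>t + 1\<close> is \<open>2 \<noteq> 0\<close>, so it is a genuine quotient (see \<open>euler_poly_gf\<close>), and
  \<open>n!\<close> times its \<open>n\<close>-th coefficient is polynomial in \<open>x\<close> (see \<open>euler_poly_is_poly\<close>).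
\<close>

definition euler_poly :: "nat \<Rightarrow> 'a::field_char_0 \<Rightarrow> 'a" where
  "euler_poly n x = fact n * fps_nth (fps_const 2 / (fps_exp 1 + 1) * fps_exp x) n"

lemma euler_poly_gf:
  fixes x :: "'a::field_char_0"
  shows "Abs_fps (\<lambda>n. euler_poly n x / fact n) * (fps_exp 1 + 1) = fps_const 2 * fps_exp x"
proof -
  have unit: "fps_nth (fps_exp 1 + 1 :: 'a fps) 0 \<noteq> 0"
    by simp
  have "Abs_fps (\<lambda>n. euler_poly n x / fact n) = fps_const 2 / (fps_exp 1 + 1) * fps_exp x"
    by (simp add: euler_poly_def fps_eq_iff)
  then have "Abs_fps (\<lambda>n. euler_poly n x / fact n) * (fps_exp 1 + 1)
      = fps_const 2 * fps_exp x * (inverse (fps_exp 1 + 1) * (fps_exp 1 + 1))"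
    using fps_divide_unit[OF unit] by (simp add: mult_ac)
  then show ?thesis
    using inverse_mult_eq_1[OF unit] by simp
qed

lemma euler_poly_is_poly:
  "\<exists>p :: 'a::field_char_0 poly. degree p \<le> n \<and> (\<forall>x. euler_poly n x = poly p x)"
proof -
  define c :: "nat \<Rightarrow> 'a" where "c = fps_nth (fps_const 2 / (fps_exp 1 + 1))"
  define p where "p = (\<Sum>i=0..n. monom (fact n * c i / fact (n - i)) (n - i))"
  have "degree p \<le> n"
    unfolding p_def by (intro degree_sum_le) (auto intro: order_trans[OF degree_monom_le])
  moreover have "euler_poly n x = poly p x" for x
    unfolding euler_poly_def p_def c_def fps_mult_nth poly_sum poly_monom sum_distrib_left
    by (simp add: mult.assoc)
  ultimately show ?thesis
    by blast
qed

end

theory Submission imports Defs begin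

text \<open>
  Rescaling \<open>t\<close> to \<open>b c t\<close> in the generating function of \<open>E\<^sub>n(a y)\<close> gives
  \<open>2 exp(a b c y t) / (exp(b c t) + 1)\<close>. A product of three such series, one for each choice of the
  distinguished weight, is therefore
  \<open>8 exp(a b c (y\<^sub>1 + y\<^sub>2 + y\<^sub>3) t) / ((exp(b c t) + 1) (exp(a c t) + 1) (exp(a b t) + 1))\<close>,
  which is symmetric in \<open>a, b, c\<close>; its coefficients are the sums in question.
\<close>

unbundle fps_syntax

definition scaled_euler_fps :: "'a::field_char_0 \<Rightarrow> 'a \<Rightarrow> 'a fps" where
  "scaled_euler_fps c x = Abs_fps (\<lambda>n. c ^ n * euler_poly n x / fact n)"

text \<open>Substituting \<open>c * t\<close> for \<open>t\<close> is a ring homomorphism, so it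
  carries over both sides of \<open>euler_poly_gf\<close>. The series \<open>fps_exp c + 1\<close>
  has constant coefficient 2, hence is invertible for every \<open>c\<close>, including 0.\<close>

lemma scaled_euler_fps_eq:
  "scaled_euler_fps c x = fps_const 2 * inverse (fps_exp c + 1) * fps_exp (c * x)"
proof -
  have "scaled_euler_fps c x = Abs_fps (\<lambda>n. euler_poly n x / fact n) oo (fps_const c * fps_X)"
    by (simp add: scaled_euler_fps_def fps_compose_linear)
  then have "scaled_euler_fps c x * (fps_exp c + 1)
      = (Abs_fps (\<lambda>n. euler_poly n x / fact n) * (fps_exp 1 + 1)) oo (fps_const c * fps_X)"
    by (simp add: fps_compose_mult_distrib fps_compose_add_distrib)
  also have "\<dots> = fps_const 2 * fps_exp (c * x)"
    unfolding euler_poly_gf by (simp add: fps_compose_mult_distrib mult.commute[of x])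
  finally have "scaled_euler_fps c x * (fps_exp c + 1) = fps_const 2 * fps_exp (c * x)" .
  moreover have "(fps_exp c + 1) * inverse (fps_exp c + 1) = (1 :: 'a fps)"
    by (rule inverse_mult_eq_1') simp
  ultimately have "scaled_euler_fps c x = fps_const 2 * fps_exp (c * x) * inverse (fps_exp c + 1)"
    by (metis mult.assoc mult.right_neutral)
  then show ?thesis
    by (simp only: mult_ac)
qed

text \<open>The scale of each factor supplies the two weights that its argument lacks, so all three
  exponents share the coefficient \<open>a * b * c\<close>.\<close>

lemma scaled_euler_fps_product:
  "scaled_euler_fps (b * c) (a * x) * scaled_euler_fps (a * c) (b * y) * scaled_euler_fps (a * b) (c * z)
    = fps_const 8 * fps_exp (a * b * c * (x + y + z))
      * (inverse (fps_exp (b * c) + 1) * inverse (fps_exp (a * c) + 1) * inverse (fps_exp (a * b) + 1))"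
proof -
  have "fps_exp (a * b * c * (x + y + z))
      = fps_exp (b * c * (a * x)) * fps_exp (a * c * (b * y)) * fps_exp (a * b * (c * z))"
    by (simp add: fps_exp_add_mult[symmetric] algebra_simps)
  moreover have "fps_const (8::'a) = fps_const 2 * fps_const 2 * fps_const 2"
    by (simp add: fps_const_mult)
  ultimately show ?thesis
    by (simp only: scaled_euler_fps_eq mult_ac)
qed

lemma fps_mult3_nth:
  fixes f g h :: "'a::comm_semiring_1 fps"
  shows "(f * g * h) $ n = (\<Sum>(k, l, m) \<in> {(k, l, m). k + l + m = n}. f $ k * g $ l * h $ m)"
proof -
  have "(f * g * h) $ n = (\<Sum>(k, j) \<in> (SIGMA k:{0..n}. {0..n-k}). f $ k * g $ j * h $ (n - k - j))"
    by (simp add: mult.assoc fps_mult_nth sum_distrib_left sum.Sigma)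
  also have "\<dots> = (\<Sum>(k, l, m) \<in> {(k, l, m). k + l + m = n}. f $ k * g $ l * h $ m)"
    \<comment> \<open>The third index is determined by the first two; the truncated subtraction is
      exact because \<open>k + j \<le> n\<close> on the index set.\<close>
    by (rule sum.reindex_bij_witness[of _ "\<lambda>(k, l, m). (k, l)" "\<lambda>(k, j). (k, j, n - k - j)"]) auto
  finally show ?thesis .
qed

definition euler_triple_sum :: "nat \<Rightarrow> 'a::field_char_0 \<Rightarrow> 'a \<Rightarrow> 'a \<Rightarrow> 'a \<Rightarrow> 'a \<Rightarrow> 'a \<Rightarrow> 'a" where
  "euler_triple_sum n x y z a b c = (\<Sum>(k, l, m) \<in> {(k, l, m). k + l + m = n}.
      fact n / (fact k * fact l * fact m)
      * euler_poly k (a * x) * euler_poly l (b * y) * euler_poly m (c * z)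
      * a ^ (l + m) * b ^ (k + m) * c ^ (k + l))"

text \<open>The powers match because \<open>(b * c) ^ k * (a * c) ^ l * (a * b) ^ m\<close> regroups
  by base into \<open>a ^ (l + m) * b ^ (k + m) * c ^ (k + l)\<close>.\<close>

lemma euler_triple_sum_eq:
  "euler_triple_sum n x y z a b c = fact n * (fps_const 8 * fps_exp (a * b * c * (x + y + z))
      * (inverse (fps_exp (b * c) + 1) * inverse (fps_exp (a * c) + 1) * inverse (fps_exp (a * b) + 1))) $ n"
  unfolding scaled_euler_fps_product[symmetric] fps_mult3_nth euler_triple_sum_def sum_distrib_left
  by (intro sum.cong)
    (auto simp: scaled_euler_fps_def power_add power_mult_distrib divide_simps mult_ac)

text \<open>Exchanging weights only permutes factors of the closed form. This swap and the next
  generate all permutations of the weights.\<close>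

lemma euler_triple_sum_swap12: "euler_triple_sum n x y z a b c = euler_triple_sum n x y z b a c"
  unfolding euler_triple_sum_eq by (simp only: mult_ac)

lemma euler_triple_sum_swap23: "euler_triple_sum n x y z a b c = euler_triple_sum n x y z a c b"
  unfolding euler_triple_sum_eq by (simp only: mult_ac)

theorem theorem1:
  fixes w1 w2 w3 n :: nat
    and y1 y2 y3 :: "'a::field_char_0"
  assumes "w1 > 0" and "w2 > 0" and "w3 > 0"
  shows
    "let S1 = (\<Sum>(k, l, m) \<in> {(k, l, m). k + l + m = n}.
              fact n / (fact k * fact l * fact m)
              * euler_poly k (of_nat w1 * y1) * euler_poly l (of_nat w2 * y2) * euler_poly m (of_nat w3 * y3)
              * of_nat w1 ^ (l + m) * of_nat w2 ^ (k + m) * of_nat w3 ^ (k + l));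
       S2 = (\<Sum>(k, l, m) \<in> {(k, l, m). k + l + m = n}.
              fact n / (fact k * fact l * fact m)
              * euler_poly k (of_nat w1 * y1) * euler_poly l (of_nat w3 * y2) * euler_poly m (of_nat w2 * y3)
              * of_nat w1 ^ (l + m) * of_nat w3 ^ (k + m) * of_nat w2 ^ (k + l));
       S3 = (\<Sum>(k, l, m) \<in> {(k, l, m). k + l + m = n}.
              fact n / (fact k * fact l * fact m)
              * euler_poly k (of_nat w2 * y1) * euler_poly l (of_nat w1 * y2) * euler_poly m (of_nat w3 * y3)
              * of_nat w2 ^ (l + m) * of_nat w1 ^ (k + m) * of_nat w3 ^ (k + l));
       S4 = (\<Sum>(k, l, m) \<in> {(k, l, m). k + l + m = n}.
              fact n / (fact k * fact l * fact m)
              * euler_poly k (of_nat w2 * y1) * euler_poly l (of_nat w3 * y2) * euler_poly m (of_nat w1 * y3)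
              * of_nat w2 ^ (l + m) * of_nat w3 ^ (k + m) * of_nat w1 ^ (k + l));
       S5 = (\<Sum>(k, l, m) \<in> {(k, l, m). k + l + m = n}.
              fact n / (fact k * fact l * fact m)
              * euler_poly k (of_nat w3 * y1) * euler_poly l (of_nat w1 * y2) * euler_poly m (of_nat w2 * y3)
              * of_nat w3 ^ (l + m) * of_nat w1 ^ (k + m) * of_nat w2 ^ (k + l));
       S6 = (\<Sum>(k, l, m) \<in> {(k, l, m). k + l + m = n}.
              fact n / (fact k * fact l * fact m)
              * euler_poly k (of_nat w3 * y1) * euler_poly l (of_nat w2 * y2) * euler_poly m (of_nat w1 * y3)
              * of_nat w3 ^ (l + m) * of_nat w2 ^ (k + m) * of_nat w1 ^ (k + l))
     in S1 = S2 \<and> S2 = S3 \<and> S3 = S4 \<and> S4 = S5 \<and> S5 = S6"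
  unfolding Let_def euler_triple_sum_def[symmetric]
  \<comment> \<open>The swaps act as ordered rewrite rules: adjacent transpositions sort the
    weights, so all six sums reach the same normal form.\<close>
  by (simp only: euler_triple_sum_swap12 euler_triple_sum_swap23 simp_thms)

end
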